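(* Let $x=(x^+;x^-;\xi)$ be a feasible point of problem (MPCC), and assume that $f$ is convex. Then the following statements are equivalent: (a) $x$ is a local minimizer of (MPCC); (b) there exist $\mu\in\mathbb{R}$, $\beta_1,\beta_2,\beta_3,\beta_4\in\mathbb{R}^n$ and $\pi\in\mathbb{R}^m$ such that the first-order KKT conditions of (MPCC) hold at $x$ with these multipliers.
   Context: Let $A\in\mathbb{R}^{m\times n}$, $b\in\mathbb{R}^m$, $\gamma>0$, and $f=f_Q+g:\mathbb{R}^n\to\mathbb{R}$ where $f_Q$ is a quadratic function and $g$ is a smooth convex function; $e$ is the all-ones vector and $(u;v;w)$ denotes stacking of column vectors. Problem (MPCC): $\min_{x^+,x^-,\xi\in\mathbb{R}^n} f(x^+-x^-)+\gamma e^T(e-\xi)$ subject to $A(x^+-x^-)\ge b$, $(x^++x^-)^T\xi=0$, $x^+\ge 0$, $x^-\ge 0$, $0\le\xi_i\le1$ for $i=1,\dots,n$. First-order KKT conditions of (MPCC) at $(x^+;x^-;\xi)$ with multipliers $(\mu,\beta_1,\beta_2,\beta_3,\beta_4,\pi)$: $$0=\begin{pmatrix}\nabla f(x^+-x^-) \\ -\nabla f(x^+-x^-) \\ -\gamma e\end{pmatrix}+\mu\begin{pmatrix}\xi \\ \xi \\ {x^+}+x^-\end{pmatrix}+\begin{pmatrix}-\beta_1-A^T\pi \\ -\beta_2+A^T\pi \\ \beta_4-\beta_3\end{pmatrix},$$ $0\le\beta_1\perp x^+\ge0$, $0\le\beta_2\perp x^-\ge0$, $0\le\beta_3\perp\xi\ge0$,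 $0\le\beta_4\perp e-\xi\ge0$, $0\le\pi\perp A(x^+-x^-)-b\ge0$, and $(x^++x^-)^T\xi=0$. Here $a\perp c$ means $a_ic_i=0$ for all $i$. *)

theory Defs
  imports "HOL-Analysis.Analysis"
begin

(* On real ^ 'n the order is componentwise and the constant 1 is the all-ones vector. *)

(* No symmetry or nonsingularity of Q is required, so affine functions are included. *)
definition quadratic_fun :: "(real ^ 'n \<Rightarrow> real) \<Rightarrow> bool" where
  "quadratic_fun q \<longleftrightarrow>
     (\<exists>(Q :: real ^ 'n ^ 'n) c d. \<forall>x. q x = (1 / 2) * (x \<bullet> (Q *v x)) + c \<bullet> x + d)"

(* "Smooth" is read as continuously differentiable. *)
definition smooth_fun :: "('a :: real_inner \<Rightarrow> real) \<Rightarrow> bool" where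
  "smooth_fun g \<longleftrightarrow> (\<exists>g'. (\<forall>x. GDERIV g x :> g' x) \<and> continuous_on UNIV g')"

(* Unspecified where f is not differentiable. *)
definition grad :: "('a :: real_inner \<Rightarrow> real) \<Rightarrow> 'a \<Rightarrow> 'a" where
  "grad f x = (THE D. GDERIV f x :> D)"

definition local_minimizer :: "('a :: metric_space \<Rightarrow> real) \<Rightarrow> 'a set \<Rightarrow> 'a \<Rightarrow> bool" where
  "local_minimizer F S x \<longleftrightarrow>
     x \<in> S \<and> (\<exists>\<epsilon>>0. \<forall>y\<in>S. dist y x < \<epsilon> \<longrightarrow> F x \<le> F y)"

(* Componentwise complementarity of two nonnegative vectors: 0 <= a, 0 <= c, a perp c. *)
definition complementary :: "real ^ 'k \<Rightarrow> real ^ 'k \<Rightarrow> bool" where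
  "complementary a c \<longleftrightarrow> 0 \<le> a \<and> (\<forall>i. a $ i * c $ i = 0) \<and> 0 \<le> c"

(* The stacked vector (x+; x-; xi) is a triple (xp, xm, \<xi>); the product metric of triples is the
   Euclidean metric of the stacked vector. *)

definition mpcc_feasible ::
  "real ^ 'n ^ 'm \<Rightarrow> real ^ 'm \<Rightarrow> ((real ^ 'n) \<times> (real ^ 'n) \<times> (real ^ 'n)) set" where
  "mpcc_feasible A b =
     {(xp, xm, \<xi>). A *v (xp - xm) \<ge> b \<and> (xp + xm) \<bullet> \<xi> = 0 \<and> xp \<ge> 0 \<and> xm \<ge> 0 \<and>
        (\<forall>i. 0 \<le> \<xi> $ i \<and> \<xi> $ i \<le> 1)}"

definition mpcc_objective ::
  "(real ^ 'n \<Rightarrow> real) \<Rightarrow> real \<Rightarrow> (real ^ 'n) \<times> (real ^ 'n) \<times> (real ^ 'n) \<Rightarrow> real" where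
  "mpcc_objective f \<gamma> = (\<lambda>(xp, xm, \<xi>). f (xp - xm) + \<gamma> * (1 \<bullet> (1 - \<xi>)))"

definition mpcc_KKT ::
  "(real ^ 'n \<Rightarrow> real) \<Rightarrow> real \<Rightarrow> real ^ 'n ^ 'm \<Rightarrow> real ^ 'm \<Rightarrow>
   (real ^ 'n) \<times> (real ^ 'n) \<times> (real ^ 'n) \<Rightarrow>
   real \<Rightarrow> real ^ 'n \<Rightarrow> real ^ 'n \<Rightarrow> real ^ 'n \<Rightarrow> real ^ 'n \<Rightarrow> real ^ 'm \<Rightarrow> bool" where
  "mpcc_KKT f \<gamma> A b = (\<lambda>(xp, xm, \<xi>) \<mu> \<beta>1 \<beta>2 \<beta>3 \<beta>4 \<pi>.
     0 = (grad f (xp - xm), - grad f (xp - xm), - (\<gamma> *\<^sub>R 1))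
         + \<mu> *\<^sub>R (\<xi>, \<xi>, xp + xm)
         + (- \<beta>1 - transpose A *v \<pi>, - \<beta>2 + transpose A *v \<pi>, \<beta>4 - \<beta>3) \<and>
     complementary \<beta>1 xp \<and>
     complementary \<beta>2 xm \<and>
     complementary \<beta>3 \<xi> \<and>
     complementary \<beta>4 (1 - \<xi>) \<and>
     complementary \<pi> (A *v (xp - xm) - b) \<and>
     (xp + xm) \<bullet> \<xi> = 0)"

end

theory Submission
  imports Defs
begin

text \<open>
  The complementarity constraint couples the blocks only through the index set
  \<open>I = {i. p\<^sub>i + m\<^sub>i = 0}\<close>, where \<open>(p, m, \<xi>)\<close> is the point under consideration,
  and each implication rests on one observation about it.

  For sufficiency, let \<open>(p', m', \<xi>')\<close> be feasible and near \<open>(p, m, \<xi>)\<close>. Positive entries of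
  \<open>\<xi>\<close> and of \<open>p + m\<close> stay positive, so feasibility of the new point forces both cross terms
  \<open>\<xi> \<bullet> (p' + m')\<close> and \<open>(p + m) \<bullet> \<xi>'\<close> to vanish. Hence the term of the KKT system with the
  multiplier \<open>\<mu>\<close>, which has no sign, does not contribute, and the usual argument for convex
  problems applies: the increase of the objective is at least its linearization, which is a
  sum of products of nonnegative vectors (\<open>mpcc_KKT_imp_local_minimizer\<close>).

  For necessity, the problem reduces to one with linear constraints. Since
  \<open>\<gamma> > 0\<close>, an index \<open>i \<in> I\<close> with \<open>\<xi>\<^sub>i < 1\<close> would allow a decrease by raising \<open>\<xi>\<^sub>i\<close>;
  so a local minimizer has \<open>\<xi> = 1\<close> on \<open>I\<close> and \<open>\<xi> = 0\<close> off \<open>I\<close>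
  (\<open>local_minimizer_xi_eq_1\<close>). With \<open>\<xi>\<close> kept fixed, the point \<open>z = p - m\<close> minimizes \<open>f\<close>
  locally subject to linear constraints: \<open>A z \<ge> b\<close>, and \<open>z\<^sub>i = 0\<close> on \<open>I\<close>
  (\<open>local_minimizer_first_order\<close>). Farkas' lemma then gives
  \<open>\<nabla>f(z) = A\<^sup>T \<pi> + \<nu>\<close> with \<open>\<nu>\<close> supported on \<open>I\<close> (\<open>farkas_mixed\<close>). The remaining
  multipliers are read off from the KKT equations; all of them become nonnegative once
  \<open>\<mu>\<close> is large, because \<open>\<mu>\<close> enters with the coefficient \<open>\<xi>\<^sub>i = 1\<close> on \<open>I\<close> and with the
  coefficient \<open>p\<^sub>i + m\<^sub>i > 0\<close> off \<open>I\<close>.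
\<close>

section \<open>Farkas' lemma\<close>

text \<open>
  A finitely generated cone is closed, so a point outside it can be strictly separated from it.
  The normal of the separating hyperplane is nonnegative on the generators because the cone is
  unbounded along each of them.
\<close>
lemma farkas_convex_cone_hull:
  fixes c :: "'a :: euclidean_space"
  assumes "finite S"
    and nonneg: "\<And>d. (\<And>s. s \<in> S \<Longrightarrow> 0 \<le> s \<bullet> d) \<Longrightarrow> 0 \<le> c \<bullet> d"
  shows "c \<in> convex_cone hull S"
proof (rule ccontr)
  let ?K = "convex_cone hull S"
  assume "c \<notin> ?K"
  then obtain u \<beta> where u: "u \<bullet> c < \<beta>" "\<And>y. y \<in> ?K \<Longrightarrow> \<beta> < u \<bullet> y"
    using separating_hyperplane_closed_point[of ?K c] convex_convex_cone_hull
      closed_convex_cone_hull[OF \<open>finite S\<close>] by metis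
  have "\<beta> < 0"
    using u(2)[OF convex_cone_hull_contains_0] by simp
  have "0 \<le> u \<bullet> s" if "s \<in> S" for s
  proof (rule ccontr)
    assume neg: "\<not> 0 \<le> u \<bullet> s"
    \<comment> \<open>The multiple of \<open>s\<close> that lies on the separating hyperplane itself.\<close>
    have "(\<beta> / (u \<bullet> s)) *\<^sub>R s \<in> ?K"
      using \<open>\<beta> < 0\<close> neg that by (intro convex_cone_hull_mul hull_inc) (auto simp: divide_nonpos_neg)
    from u(2)[OF this] show False
      using neg by simp
  qed
  then have "0 \<le> c \<bullet> u"
    by (intro nonneg) (simp add: inner_commute)
  with u(1) \<open>\<beta> < 0\<close> show False
    by (simp add: inner_commute)
qed

text \<open>
  The form needed for first-order conditions under linear constraints, with equations on the
  coordinates in \<open>I\<close> and inequalities on the rows in \<open>J\<close>. An equation counts as two opposite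
  inequalities, so the generators of the cone are the rows of \<open>A\<close> in \<open>J\<close> and the signed unit
  vectors in \<open>I\<close>; the two signs are why \<open>\<nu>\<close> carries no sign condition.
\<close>
lemma farkas_mixed:
  fixes A :: "real ^ 'n ^ 'm" and c :: "real ^ 'n"
  assumes nonneg: "\<And>d. \<lbrakk>\<And>i. i \<in> I \<Longrightarrow> d $ i = 0; \<And>j. j \<in> J \<Longrightarrow> 0 \<le> (A *v d) $ j\<rbrakk> \<Longrightarrow> 0 \<le> c \<bullet> d"
  obtains \<pi> \<nu> where "c = transpose A *v \<pi> + \<nu>" "0 \<le> \<pi>"
    "\<And>j. j \<notin> J \<Longrightarrow> \<pi> $ j = 0" "\<And>i. i \<notin> I \<Longrightarrow> \<nu> $ i = 0"
proof -
  define S where "S = (\<lambda>j. A $ j) ` J \<union> (\<lambda>i. axis i 1) ` I \<union> (\<lambda>i. - axis i 1) ` I"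
  define K where "K = {transpose A *v \<pi> + \<nu> | \<pi> \<nu>.
    0 \<le> \<pi> \<and> (\<forall>j. j \<notin> J \<longrightarrow> \<pi> $ j = 0) \<and> (\<forall>i. i \<notin> I \<longrightarrow> \<nu> $ i = 0)}"
  have KI: "transpose A *v \<pi> + \<nu> \<in> K"
    if "0 \<le> \<pi>" "\<And>j. j \<notin> J \<Longrightarrow> \<pi> $ j = 0" "\<And>i. i \<notin> I \<Longrightarrow> \<nu> $ i = 0" for \<pi> \<nu>
    using that unfolding K_def by blast
  have "c \<in> convex_cone hull S"
  proof (rule farkas_convex_cone_hull)
    show "finite S"
      by (simp add: S_def)
  next
    fix d :: "real ^ 'n"
    assume S: "\<And>s. s \<in> S \<Longrightarrow> 0 \<le> s \<bullet> d"
    show "0 \<le> c \<bullet> d"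
    proof (rule nonneg)
      fix i assume "i \<in> I"
      then show "d $ i = 0"
        using S[of "axis i 1"] S[of "- axis i 1"]
        by (force simp: S_def inner_axis' intro: antisym)
    next
      fix j assume "j \<in> J"
      then show "0 \<le> (A *v d) $ j"
        using S[of "A $ j"] by (simp add: S_def matrix_vector_mul_component)
    qed
  qed
  also have "convex_cone hull S \<subseteq> K"
  proof (rule hull_minimal)
    show "convex_cone K"
      unfolding convex_cone_iff
    proof (intro conjI ballI allI impI)
      show "0 \<in> K"
        using KI[of 0 0] by simp
    next
      fix x y assume "x \<in> K" "y \<in> K"
      then obtain \<pi> \<nu> \<pi>' \<nu>' where
        x: "x = transpose A *v \<pi> + \<nu>" "0 \<le> \<pi>" "\<forall>j. j \<notin> J \<longrightarrow> \<pi> $ j = 0" "\<forall>i. i \<notin> I \<longrightarrow> \<nu> $ i = 0" and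
        y: "y = transpose A *v \<pi>' + \<nu>'" "0 \<le> \<pi>'" "\<forall>j. j \<notin> J \<longrightarrow> \<pi>' $ j = 0" "\<forall>i. i \<notin> I \<longrightarrow> \<nu>' $ i = 0"
        unfolding K_def by blast
      have "x + y = transpose A *v (\<pi> + \<pi>') + (\<nu> + \<nu>')"
        unfolding x(1) y(1) matrix_vector_right_distrib by simp
      also have "\<dots> \<in> K"
        using x y by (intro KI) (simp_all add: add_nonneg_nonneg)
      finally show "x + y \<in> K" .
    next
      fix x and t :: real assume "x \<in> K" "0 \<le> t"
      then obtain \<pi> \<nu> where
        x: "x = transpose A *v \<pi> + \<nu>" "0 \<le> \<pi>" "\<forall>j. j \<notin> J \<longrightarrow> \<pi> $ j = 0" "\<forall>i. i \<notin> I \<longrightarrow> \<nu> $ i = 0"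
        unfolding K_def by blast
      have "t *\<^sub>R x = transpose A *v (t *\<^sub>R \<pi>) + t *\<^sub>R \<nu>"
        unfolding x(1) matrix_vector_mult_scaleR by (simp add: scaleR_add_right)
      also have "\<dots> \<in> K"
        using x \<open>0 \<le> t\<close> by (intro KI) (simp_all add: less_eq_vec_def)
      finally show "t *\<^sub>R x \<in> K" .
    qed
  next
    have "A $ j \<in> K" if "j \<in> J" for j
    proof -
      have "transpose A *v axis j 1 + 0 \<in> K"
        using that by (intro KI) (auto simp: less_eq_vec_def axis_def)
      then show ?thesis
        by (simp add: matrix_vector_mult_basis column_transpose row_def del: transpose_matrix_vector)
    qed
    moreover have "axis i 1 \<in> K" "- axis i 1 \<in> K" if "i \<in> I" for i
    proof -
      have *: "\<nu> \<in> K" if "\<And>k. k \<notin> I \<Longrightarrow> \<nu> $ k = 0" for \<nu>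
        using KI[of 0 \<nu>] that by simp
      have "axis i 1 $ k = (0 :: real)" if "k \<notin> I" for k
        using \<open>i \<in> I\<close> that by (auto simp: axis_def)
      then show "axis i 1 \<in> K" "- axis i 1 \<in> K"
        by (auto intro!: *)
    qed
    ultimately show "S \<subseteq> K"
      unfolding S_def by blast
  qed
  finally show thesis
    using that unfolding K_def by blast
qed

section \<open>Gradients of convex functions\<close>

lemma GDERIV_imp_directional:
  assumes "GDERIV f z :> G"
  shows "((\<lambda>t. f (z + t *\<^sub>R d)) has_real_derivative G \<bullet> d) (at 0)"
proof -
  have "((\<lambda>t. z + t *\<^sub>R d) has_derivative (\<lambda>t. t *\<^sub>R d)) (at 0)"
    by (auto intro!: derivative_eq_intros)
  moreover have "(f has_derivative (\<lambda>h. h \<bullet> G)) (at (z + 0 *\<^sub>R d))"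
    using assms by (simp add: gderiv_def)
  ultimately have "((\<lambda>t. f (z + t *\<^sub>R d)) has_derivative (\<lambda>t. t *\<^sub>R d \<bullet> G)) (at 0)"
    by (rule has_derivative_compose)
  then show ?thesis
    by (simp add: has_field_derivative_def inner_commute mult.commute[of _ "inner _ _"])
qed

lemma GDERIV_imp_grad:
  assumes "GDERIV f z :> G"
  shows "grad f z = G"
  unfolding grad_def
proof (rule the_equality)
  fix D assume "GDERIV f z :> D"
  then have "(\<lambda>h. h \<bullet> D) = (\<lambda>h. h \<bullet> G)"
    using assms unfolding gderiv_def by (rule has_derivative_unique)
  then show "D = G"
    by (metis inner_commute vector_eq_ldot)
qed (fact assms)

lemma quadratic_fun_GDERIV:
  assumes "quadratic_fun q"
  obtains G where "GDERIV q z :> G"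
proof -
  obtain Q c d where q: "\<And>x. q x = (1 / 2) * (x \<bullet> (Q *v x)) + c \<bullet> x + d"
    using assms unfolding quadratic_fun_def by blast
  have "(q has_derivative (\<lambda>h. (1 / 2) * (z \<bullet> (Q *v h) + h \<bullet> (Q *v z)) + c \<bullet> h)) (at z)"
    unfolding q[abs_def]
    by (auto intro!: derivative_eq_intros bounded_linear_imp_has_derivative
        matrix_vector_mul_bounded_linear)
  moreover have "(1 / 2) * (z \<bullet> (Q *v h) + h \<bullet> (Q *v z)) + c \<bullet> h
      = h \<bullet> ((1 / 2) *\<^sub>R (z v* Q + Q *v z) + c)" for h
    by (simp add: inner_simps inner_commute flip: dot_lmul_matrix)
  ultimately show thesis
    using that by (simp add: gderiv_def)
qed

text \<open>
  Restricting to the line through \<open>z\<close> and \<open>y\<close> reduces the gradient inequality to the tangent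
  inequality for convex functions of one variable.
\<close>
lemma convex_on_imp_above_gradient:
  assumes "convex_on UNIV f" and "GDERIV f z :> G"
  shows "f z + G \<bullet> (y - z) \<le> f y"
proof -
  let ?\<phi> = "\<lambda>t. f (z + t *\<^sub>R (y - z))"
  have "convex_on UNIV ?\<phi>"
  proof (rule convex_onI)
    fix s t u :: real assume "0 < s" "s < 1"
    have "z + ((1 - s) *\<^sub>R t + s *\<^sub>R u) *\<^sub>R (y - z)
        = (1 - s) *\<^sub>R (z + t *\<^sub>R (y - z)) + s *\<^sub>R (z + u *\<^sub>R (y - z))"
      by (simp add: algebra_simps)
    then show "?\<phi> ((1 - s) *\<^sub>R t + s *\<^sub>R u) \<le> (1 - s) * ?\<phi> t + s * ?\<phi> u"
      using convex_onD[OF assms(1), of s] \<open>0 < s\<close> \<open>s < 1\<close> by simp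
  qed simp
  then have "?\<phi> 1 - ?\<phi> 0 \<ge> (G \<bullet> (y - z)) * (1 - 0)"
    by (rule convex_on_imp_above_tangent)
      (use GDERIV_imp_directional[OF assms(2)] in auto)
  then show ?thesis
    by simp
qed

section \<open>Local minimizers\<close>

lemma local_minimizer_iff_eventually:
  "local_minimizer F S x \<longleftrightarrow> x \<in> S \<and> (\<forall>\<^sub>F y in nhds x. y \<in> S \<longrightarrow> F x \<le> F y)"
  unfolding local_minimizer_def eventually_nhds_metric by blast

lemma local_minimizer_along_ray:
  fixes x d :: "'a :: real_normed_vector"
  assumes "local_minimizer F S x" and "\<forall>\<^sub>F t in at_right 0. x + t *\<^sub>R d \<in> S"
  shows "\<forall>\<^sub>F t in at_right 0. F x \<le> F (x + t *\<^sub>R d)"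
proof -
  have "((\<lambda>t. x + t *\<^sub>R d) \<longlongrightarrow> x + 0 *\<^sub>R d) (at_right 0)"
    by (intro tendsto_intros)
  then have "\<forall>\<^sub>F t in at_right 0. x + t *\<^sub>R d \<in> S \<longrightarrow> F x \<le> F (x + t *\<^sub>R d)"
    using assms(1) unfolding local_minimizer_iff_eventually
    by (auto dest: filterlim_iff[THEN iffD1, rule_format])
  then show ?thesis
    using assms(2) by eventually_elim simp
qed

lemma directional_derivative_nonneg:
  assumes "GDERIV f z :> G" and "\<forall>\<^sub>F t in at_right 0. f z \<le> f (z + t *\<^sub>R d)"
  shows "0 \<le> G \<bullet> d"
proof (rule tendsto_lowerbound)
  show "((\<lambda>t. (f (z + t *\<^sub>R d) - f z) / t) \<longlongrightarrow> G \<bullet> d) (at_right 0)"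
    using GDERIV_imp_directional[OF assms(1), of d]
    by (auto simp: DERIV_def intro: tendsto_mono[OF at_le])
  show "\<forall>\<^sub>F t in at_right 0. 0 \<le> (f (z + t *\<^sub>R d) - f z) / t"
    using assms(2) eventually_at_right_less by eventually_elim simp
qed simp

text \<open>
  Linear inequality constraints survive a small step as soon as the active ones do not decrease.
\<close>
lemma eventually_at_right_affine_ge:
  fixes l v w :: real
  assumes "l \<le> v" and "v = l \<Longrightarrow> 0 \<le> w"
  shows "\<forall>\<^sub>F t in at_right 0. l \<le> v + t * w"
proof (cases "v = l")
  case True
  show ?thesis
    using eventually_at_right_less[of "0 :: real"] by eventually_elim (use True assms(2) in simp)
next
  case False
  have "((\<lambda>t. v + t * w) \<longlongrightarrow> v + 0 * w) (at_right 0)"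
    by (intro tendsto_intros)
  from order_tendstoD(1)[OF this, of l] show ?thesis
    using False assms(1) by (auto elim: eventually_mono)
qed

section \<open>The complementarity-constrained problem\<close>

lemma inner_nonneg_eq_0_iff:
  fixes u v :: "real ^ 'n"
  assumes "0 \<le> u" "0 \<le> v"
  shows "u \<bullet> v = 0 \<longleftrightarrow> (\<forall>i. u $ i * v $ i = 0)"
  using assms unfolding inner_vec_def by (subst sum_nonneg_eq_0_iff) (auto simp: less_eq_vec_def)

lemma inner_vec_nonneg:
  fixes u v :: "real ^ 'n"
  assumes "0 \<le> u" "0 \<le> v"
  shows "0 \<le> u \<bullet> v"
  using assms unfolding inner_vec_def by (auto simp: less_eq_vec_def intro!: sum_nonneg)

lemma complementaryD:
  assumes "complementary u v"
  shows "0 \<le> u" "0 \<le> v" "u \<bullet> v = 0"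
  using assms inner_nonneg_eq_0_iff[of u v] by (auto simp: complementary_def)

text \<open>
  Complementarity is used index by index below. A sum of nonnegative products vanishes
  only if each product does.
\<close>
lemma mpcc_feasible_iff:
  "(p, m, \<xi>) \<in> mpcc_feasible A b \<longleftrightarrow>
     (\<forall>j. b $ j \<le> (A *v (p - m)) $ j) \<and> (\<forall>i. 0 \<le> p $ i) \<and> (\<forall>i. 0 \<le> m $ i) \<and>
     (\<forall>i. 0 \<le> \<xi> $ i) \<and> (\<forall>i. \<xi> $ i \<le> 1) \<and> (\<forall>i. (p $ i + m $ i) * \<xi> $ i = 0)"
  (is "?L \<longleftrightarrow> ?R")
proof -
  have "(p + m) \<bullet> \<xi> = 0 \<longleftrightarrow> (\<forall>i. (p $ i + m $ i) * \<xi> $ i = 0)"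
    if "0 \<le> p" "0 \<le> m" "0 \<le> \<xi>"
    using inner_nonneg_eq_0_iff[of "p + m" \<xi>] that by (simp add: add_nonneg_nonneg)
  then show ?thesis
    unfolding mpcc_feasible_def less_eq_vec_def by auto
qed

text \<open>
  With the KKT equations inserted, the linearized increase of the objective towards a feasible
  point \<open>(p', m', \<xi>')\<close> is
  \<open>\<beta>\<^sub>1 \<bullet> p' + \<beta>\<^sub>2 \<bullet> m' + \<beta>\<^sub>3 \<bullet> \<xi>' + \<beta>\<^sub>4 \<bullet> (1 - \<xi>') + \<pi> \<bullet> (A (p' - m') - b)
     - \<mu> (\<xi> \<bullet> (p' + m') + (p + m) \<bullet> \<xi>')\<close>.
  The bracket after \<open>\<mu>\<close> is zero near \<open>(p, m, \<xi>)\<close>. Farther away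
  it may be positive, since the feasible set is not convex, and the bound on the objective is lost.
\<close>
lemma mpcc_KKT_imp_local_minimizer:
  fixes A :: "real ^ 'n ^ 'm"
  assumes f: "convex_on UNIV f" "GDERIV f (p - m) :> G"
    and feas: "(p, m, \<xi>) \<in> mpcc_feasible A b"
    and KKT: "mpcc_KKT f \<gamma> A b (p, m, \<xi>) \<mu> \<beta>1 \<beta>2 \<beta>3 \<beta>4 \<pi>"
  shows "local_minimizer (mpcc_objective f \<gamma>) (mpcc_feasible A b) (p, m, \<xi>)"
proof -
  let ?w = "transpose A *v \<pi>"
  have G: "G = \<beta>1 + ?w - \<mu> *\<^sub>R \<xi>" "G = - \<beta>2 + ?w + \<mu> *\<^sub>R \<xi>"
    and \<gamma>: "\<gamma> *\<^sub>R 1 = \<mu> *\<^sub>R (p + m) + \<beta>4 - \<beta>3"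
    using KKT by (auto simp: mpcc_KKT_def GDERIV_imp_grad[OF f(2)] zero_prod_def algebra_simps)
  have comp: "complementary \<beta>1 p" "complementary \<beta>2 m" "complementary \<beta>3 \<xi>"
    "complementary \<beta>4 (1 - \<xi>)" "complementary \<pi> (A *v (p - m) - b)" and xi0: "(p + m) \<bullet> \<xi> = 0"
    using KKT by (simp_all add: mpcc_KKT_def)
  note comp' = comp[THEN complementaryD(1)] comp[THEN complementaryD(3)]
  have w: "?w \<bullet> d = \<pi> \<bullet> (A *v d)" for d
    by (simp add: dot_lmul_matrix)

  \<comment> \<open>The two positivity conditions are all that nearness contributes; they kill the cross terms.\<close>
  have le: "mpcc_objective f \<gamma> (p, m, \<xi>) \<le> mpcc_objective f \<gamma> (p', m', \<xi>')"
    if feas': "(p', m', \<xi>') \<in> mpcc_feasible A b"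
      and near: "\<And>i. 0 < \<xi> $ i \<Longrightarrow> 0 < \<xi>' $ i" "\<And>i. 0 < (p + m) $ i \<Longrightarrow> 0 < (p' + m') $ i"
    for p' m' \<xi>'
  proof -
    note fe = feas[unfolded mpcc_feasible_iff] and fe' = feas'[unfolded mpcc_feasible_iff]
    have cross1: "\<xi> $ i * (p' $ i + m' $ i) = 0" for i
      using near(1)[of i] fe fe' by (metis less_eq_real_def mult_eq_0_iff order_less_irrefl)
    have cross2: "(p $ i + m $ i) * \<xi>' $ i = 0" for i
    proof (cases "0 < (p + m) $ i")
      case True
      with near(2)[of i] fe' show ?thesis
        by (metis mult_eq_0_iff order_less_irrefl vector_add_component)
    next
      case False
      with fe have "p $ i + m $ i = 0"
        by (simp add: not_less) (meson add_nonneg_nonneg antisym)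
      then show ?thesis
        by simp
    qed
    have x1: "\<xi> \<bullet> p' + \<xi> \<bullet> m' = 0"
      unfolding inner_add_right[symmetric] using cross1
      by (simp only: inner_vec_def inner_real_def vector_add_component sum.neutral_const)
    have x2: "p \<bullet> \<xi>' + m \<bullet> \<xi>' = 0"
      unfolding inner_add_left[symmetric] using cross2
      by (simp only: inner_vec_def inner_real_def vector_add_component sum.neutral_const)
    have nn: "0 \<le> p'" "0 \<le> m'" "0 \<le> \<xi>'" "0 \<le> 1 - \<xi>'" "0 \<le> A *v (p' - m') - b"
      using fe' by (auto simp: less_eq_vec_def)
    note pos = comp'(1-5)[THEN inner_vec_nonneg]
    have "G \<bullet> ((p' - m') - (p - m)) = G \<bullet> (p' - p) - G \<bullet> (m' - m)"
      by (simp add: algebra_simps)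
    also have "\<dots> = (\<beta>1 + ?w - \<mu> *\<^sub>R \<xi>) \<bullet> (p' - p) - (- \<beta>2 + ?w + \<mu> *\<^sub>R \<xi>) \<bullet> (m' - m)"
      using G by metis
    also have "\<dots> = \<beta>1 \<bullet> p' + \<beta>2 \<bullet> m' + ?w \<bullet> ((p' - m') - (p - m)) - \<mu> * (\<xi> \<bullet> p' + \<xi> \<bullet> m')
        - \<beta>1 \<bullet> p - \<beta>2 \<bullet> m + \<mu> * ((p + m) \<bullet> \<xi>)"
      by (simp add: inner_simps algebra_simps inner_commute[of _ \<xi>] del: transpose_matrix_vector)
    also have "?w \<bullet> ((p' - m') - (p - m)) = \<pi> \<bullet> (A *v (p' - m') - b) - \<pi> \<bullet> (A *v (p - m) - b)"
      unfolding w by (simp add: inner_simps matrix_vector_mult_diff_distrib)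
    finally have "0 \<le> G \<bullet> ((p' - m') - (p - m))"
      using x1 xi0 comp' pos(1)[OF nn(1)] pos(2)[OF nn(2)] pos(5)[OF nn(5)] by simp
    then have "f (p - m) \<le> f (p' - m')"
      using convex_on_imp_above_gradient[OF f, of "p' - m'"] by simp
    moreover have "\<gamma> * (1 \<bullet> (1 - \<xi>)) \<le> \<gamma> * (1 \<bullet> (1 - \<xi>'))"
    proof -
      have "\<gamma> * (1 \<bullet> (1 - \<xi>')) - \<gamma> * (1 \<bullet> (1 - \<xi>)) = (\<gamma> *\<^sub>R 1) \<bullet> (\<xi> - \<xi>')"
        by (simp add: inner_simps algebra_simps)
      also have "\<dots> = \<mu> * ((p + m) \<bullet> \<xi>) - \<mu> * (p \<bullet> \<xi>' + m \<bullet> \<xi>')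
          + \<beta>4 \<bullet> (1 - \<xi>') - \<beta>4 \<bullet> (1 - \<xi>) + \<beta>3 \<bullet> \<xi>' - \<beta>3 \<bullet> \<xi>"
        unfolding \<gamma> by (simp add: inner_simps algebra_simps)
      finally show ?thesis
        using x2 xi0 comp' pos(3)[OF nn(3)] pos(4)[OF nn(4)] by simp
    qed
    ultimately show ?thesis
      by (simp add: mpcc_objective_def)
  qed

  have "\<forall>\<^sub>F y in nhds (p, m, \<xi>). 0 < \<xi> $ i \<longrightarrow> 0 < snd (snd y) $ i" for i
    by (cases "0 < \<xi> $ i")
      (auto intro!: eventually_nhds_in_open[of "{y. 0 < snd (snd y) $ i}" "(p, m, \<xi>)", simplified]
        open_Collect_less continuous_intros)
  moreover have "\<forall>\<^sub>F y in nhds (p, m, \<xi>). 0 < (p + m) $ i \<longrightarrow> 0 < (fst y + fst (snd y)) $ i" for i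
    by (cases "0 < (p + m) $ i")
      (auto intro!: eventually_nhds_in_open[of "{y. 0 < (fst y + fst (snd y)) $ i}" "(p, m, \<xi>)", simplified]
        open_Collect_less continuous_intros)
  ultimately have "\<forall>\<^sub>F y in nhds (p, m, \<xi>). \<forall>i. (0 < \<xi> $ i \<longrightarrow> 0 < snd (snd y) $ i) \<and>
      (0 < (p + m) $ i \<longrightarrow> 0 < (fst y + fst (snd y)) $ i)"
    by (intro eventually_all_finite eventually_conj)
  then have "\<forall>\<^sub>F y in nhds (p, m, \<xi>). y \<in> mpcc_feasible A b \<longrightarrow>
      mpcc_objective f \<gamma> (p, m, \<xi>) \<le> mpcc_objective f \<gamma> y"
    by (rule eventually_mono) (use le in auto)
  then show ?thesis
    using feas by (simp add: local_minimizer_iff_eventually)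
qed

text \<open>
  If both \<open>p\<close> and \<open>m\<close> vanish at \<open>i\<close>, complementarity leaves \<open>\<xi>\<^sub>i\<close> free, and increasing
  it by \<open>t\<close> lowers the objective by \<open>\<gamma> t\<close>; only the bound \<open>\<xi>\<^sub>i \<le> 1\<close> can prevent this.
\<close>
lemma local_minimizer_xi_eq_1:
  assumes "0 < \<gamma>" and loc: "local_minimizer (mpcc_objective f \<gamma>) (mpcc_feasible A b) (p, m, \<xi>)"
    and zero: "p $ i = 0" "m $ i = 0"
  shows "\<xi> $ i = 1"
proof (rule ccontr)
  assume "\<xi> $ i \<noteq> 1"
  have feas: "(p, m, \<xi>) \<in> mpcc_feasible A b"
    using loc by (simp add: local_minimizer_def)
  then have lt: "\<xi> $ i < 1"
    using \<open>\<xi> $ i \<noteq> 1\<close> by (simp add: mpcc_feasible_iff less_le)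
  let ?d = "(0, 0, axis i 1)"
  have "\<forall>\<^sub>F t in at_right 0. (p, m, \<xi>) + t *\<^sub>R ?d \<in> mpcc_feasible A b"
  proof (rule eventually_mono)
    show "\<forall>\<^sub>F t in at_right 0. t \<in> {0<..<1 - \<xi> $ i}"
      using lt by (intro eventually_at_right_real) simp
  qed (use feas zero in \<open>auto simp: mpcc_feasible_iff axis_def\<close>)
  from local_minimizer_along_ray[OF loc this]
  have "\<forall>\<^sub>F t in at_right (0 :: real). False"
    using eventually_at_right_less[of "0 :: real"]
  proof eventually_elim
    case (elim t)
    have "1 \<bullet> (1 - (\<xi> + t *\<^sub>R axis i 1)) = 1 \<bullet> (1 - \<xi>) - t"
      by (simp add: inner_simps inner_axis)
    with elim show ?case
      using \<open>0 < \<gamma>\<close> by (simp add: mpcc_objective_def algebra_simps mult_le_0_iff)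
  qed
  then show False
    by simp
qed

text \<open>
  Keeping \<open>\<xi>\<close> fixed turns the problem into one in \<open>z = p - m\<close> with linear constraints. Every
  direction \<open>d\<close> that respects them to first order lifts to a feasible direction of the full
  problem, since \<open>d\<^sub>i\<close> may be added to \<open>p\<^sub>i\<close> or subtracted from \<open>m\<^sub>i\<close>, one of which is positive
  unless \<open>d\<^sub>i = 0\<close>.
\<close>
lemma local_minimizer_first_order:
  fixes A :: "real ^ 'n ^ 'm"
  assumes loc: "local_minimizer (mpcc_objective f \<gamma>) (mpcc_feasible A b) (p, m, \<xi>)"
    and G: "GDERIV f (p - m) :> G"
    and eq: "\<And>i. p $ i + m $ i = 0 \<Longrightarrow> d $ i = 0"
    and ineq: "\<And>j. (A *v (p - m)) $ j = b $ j \<Longrightarrow> 0 \<le> (A *v d) $ j"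
  shows "0 \<le> G \<bullet> d"
proof -
  have feas: "(p, m, \<xi>) \<in> mpcc_feasible A b"
    using loc by (simp add: local_minimizer_def)
  note fe = feas[unfolded mpcc_feasible_iff]
  define dp where "dp = (\<chi> i. if 0 < p $ i then d $ i else 0)"
  define dm where "dm = (\<chi> i. if 0 < p $ i then 0 else - d $ i)"
  have d: "dp - dm = d"
    by (simp add: dp_def dm_def vec_eq_iff)
  have ray: "(p + t *\<^sub>R dp) - (m + t *\<^sub>R dm) = (p - m) + t *\<^sub>R d" for t
    by (simp add: algebra_simps flip: d)
  have "\<forall>\<^sub>F t in at_right 0. b $ j \<le> (A *v (p - m)) $ j + t * (A *v d) $ j" for j
    using fe ineq by (intro eventually_at_right_affine_ge) auto
  moreover have "\<forall>\<^sub>F t in at_right 0. 0 \<le> p $ i + t * dp $ i" for i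
    using fe by (intro eventually_at_right_affine_ge) (auto simp: dp_def)
  moreover have "\<forall>\<^sub>F t in at_right 0. 0 \<le> m $ i + t * dm $ i" for i
  proof (intro eventually_at_right_affine_ge)
    assume "m $ i = 0"
    moreover have "0 \<le> p $ i"
      using fe by blast
    ultimately show "0 \<le> dm $ i"
      using eq[of i] by (cases "p $ i = 0") (auto simp: dm_def)
  qed (use fe in auto)
  ultimately have "\<forall>\<^sub>F t in at_right 0.
      (\<forall>j. b $ j \<le> (A *v (p - m)) $ j + t * (A *v d) $ j) \<and>
      (\<forall>i. 0 \<le> p $ i + t * dp $ i) \<and> (\<forall>i. 0 \<le> m $ i + t * dm $ i)"
    by (intro eventually_conj eventually_all_finite)
  then have "\<forall>\<^sub>F t in at_right 0. (p, m, \<xi>) + t *\<^sub>R (dp, dm, 0) \<in> mpcc_feasible A b"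
  proof (rule eventually_mono)
    fix t
    assume t: "(\<forall>j. b $ j \<le> (A *v (p - m)) $ j + t * (A *v d) $ j) \<and>
      (\<forall>i. 0 \<le> p $ i + t * dp $ i) \<and> (\<forall>i. 0 \<le> m $ i + t * dm $ i)"
    have "(p $ i + t * dp $ i + (m $ i + t * dm $ i)) * \<xi> $ i = 0" for i
    proof (cases "\<xi> $ i = 0")
      case False
      with fe have "p $ i + m $ i = 0"
        by (metis mult_eq_0_iff)
      with eq[of i] show ?thesis
        by (simp add: dp_def dm_def)
    qed simp
    with t fe show "(p, m, \<xi>) + t *\<^sub>R (dp, dm, 0) \<in> mpcc_feasible A b"
      by (simp add: mpcc_feasible_iff ray matrix_vector_right_distrib matrix_vector_mult_scaleR)
  qed
  from local_minimizer_along_ray[OF loc this]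
  have "\<forall>\<^sub>F t in at_right 0. f (p - m) \<le> f ((p - m) + t *\<^sub>R d)"
    by (simp add: mpcc_objective_def ray)
  with G show ?thesis
    by (rule directional_derivative_nonneg)
qed

text \<open>
  Given \<open>\<nabla>f(p - m) = A\<^sup>T \<pi> + \<nu>\<close>, the KKT equations determine \<open>\<beta>\<^sub>1 = \<nu> + \<mu> \<xi>\<close>,
  \<open>\<beta>\<^sub>2 = - \<nu> + \<mu> \<xi>\<close> and \<open>\<beta>\<^sub>3 - \<beta>\<^sub>4 = \<mu> (p + m) - \<gamma>\<close>. Both \<open>\<nu>\<close> and \<open>\<xi>\<close> are supported on
  \<open>I\<close>, where \<open>p\<close> and \<open>m\<close> vanish. If \<open>\<beta>\<^sub>4\<close> takes the difference on \<open>I\<close> and \<open>\<beta>\<^sub>3\<close> takes it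
  off \<open>I\<close>, complementarity holds for every \<open>\<mu>\<close>, and only the signs constrain \<open>\<mu>\<close>.
\<close>
lemma local_minimizer_imp_mpcc_KKT:
  fixes A :: "real ^ 'n ^ 'm"
  assumes "0 < \<gamma>" and loc: "local_minimizer (mpcc_objective f \<gamma>) (mpcc_feasible A b) (p, m, \<xi>)"
    and G: "GDERIV f (p - m) :> G"
  shows "\<exists>\<mu> \<beta>1 \<beta>2 \<beta>3 \<beta>4 \<pi>. mpcc_KKT f \<gamma> A b (p, m, \<xi>) \<mu> \<beta>1 \<beta>2 \<beta>3 \<beta>4 \<pi>"
proof -
  let ?s = "\<lambda>i. p $ i + m $ i"
  define I where "I = {i. ?s i = 0}"
  have feas: "(p, m, \<xi>) \<in> mpcc_feasible A b"
    using loc by (simp add: local_minimizer_def)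
  note fe = feas[unfolded mpcc_feasible_iff]
  have I: "p $ i = 0" "m $ i = 0" "\<xi> $ i = 1" if "i \<in> I" for i
  proof -
    show *: "p $ i = 0" "m $ i = 0"
      using that fe by (auto simp: I_def add_nonneg_eq_0_iff)
    show "\<xi> $ i = 1"
      using local_minimizer_xi_eq_1[OF assms(1) loc *] .
  qed
  have notI: "0 < ?s i" "\<xi> $ i = 0" if "i \<notin> I" for i
    using that fe by (auto simp: I_def less_le)
  obtain \<pi> \<nu> where \<pi>: "G = transpose A *v \<pi> + \<nu>" "0 \<le> \<pi>"
      "\<And>j. j \<notin> {j. (A *v (p - m)) $ j = b $ j} \<Longrightarrow> \<pi> $ j = 0"
    and \<nu>: "\<And>i. i \<notin> I \<Longrightarrow> \<nu> $ i = 0"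
  proof (rule farkas_mixed)
    fix d :: "real ^ 'n"
    assume "\<And>i. i \<in> I \<Longrightarrow> d $ i = 0"
      and "\<And>j. j \<in> {j. (A *v (p - m)) $ j = b $ j} \<Longrightarrow> 0 \<le> (A *v d) $ j"
    then show "0 \<le> G \<bullet> d"
      by (intro local_minimizer_first_order[OF loc G]) (auto simp: I_def)
  qed blast
  \<comment> \<open>The first bound makes \<open>\<beta>1\<close> and \<open>\<beta>2\<close> nonnegative on \<open>I\<close>, the second makes \<open>\<beta>3\<close> nonnegative
    off \<open>I\<close>; on \<open>I\<close> the quotient \<open>\<gamma> / 0 = 0\<close> is harmless.\<close>
  define \<mu> where "\<mu> = Max (range (\<lambda>i. max \<bar>\<nu> $ i\<bar> (\<gamma> / ?s i)))"
  have \<mu>: "\<bar>\<nu> $ i\<bar> \<le> \<mu>" "\<gamma> / ?s i \<le> \<mu>" for i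
  proof -
    have "max \<bar>\<nu> $ i\<bar> (\<gamma> / ?s i) \<le> \<mu>"
      unfolding \<mu>_def by (rule Max_ge) auto
    then show "\<bar>\<nu> $ i\<bar> \<le> \<mu>" "\<gamma> / ?s i \<le> \<mu>"
      by auto
  qed
  define \<beta>1 where "\<beta>1 = \<nu> + \<mu> *\<^sub>R \<xi>"
  define \<beta>2 where "\<beta>2 = - \<nu> + \<mu> *\<^sub>R \<xi>"
  define \<beta>3 where "\<beta>3 = (\<chi> i. if i \<in> I then 0 else \<mu> * ?s i - \<gamma>)"
  define \<beta>4 where "\<beta>4 = (\<chi> i. if i \<in> I then \<gamma> else 0)"
  have \<beta>: "(if i \<in> I then \<beta>1 $ i = \<nu> $ i + \<mu> \<and> \<beta>2 $ i = - \<nu> $ i + \<mu> \<and> \<beta>3 $ i = 0 \<and> \<beta>4 $ i = \<gamma>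
      else \<beta>1 $ i = 0 \<and> \<beta>2 $ i = 0 \<and> \<beta>3 $ i = \<mu> * ?s i - \<gamma> \<and> \<beta>4 $ i = 0)" for i
    using I(3)[of i] notI(2)[of i] \<nu>[of i] by (simp add: \<beta>1_def \<beta>2_def \<beta>3_def \<beta>4_def)
  have "0 \<le> \<beta>1 $ i \<and> 0 \<le> \<beta>2 $ i \<and> 0 \<le> \<beta>3 $ i \<and> 0 \<le> \<beta>4 $ i \<and> \<beta>1 $ i * p $ i = 0 \<and> \<beta>2 $ i * m $ i = 0
      \<and> \<beta>3 $ i * \<xi> $ i = 0 \<and> \<beta>4 $ i * (1 - \<xi> $ i) = 0 \<and> - \<gamma> + \<mu> * ?s i + \<beta>4 $ i - \<beta>3 $ i = 0" for i
  proof (cases "i \<in> I")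
    case True
    with \<beta>[of i] I[OF True] \<mu>(1)[of i] \<open>0 < \<gamma>\<close> show ?thesis
      by auto
  next
    case False
    with \<beta>[of i] notI[OF False] \<mu>(2)[of i] show ?thesis
      by (simp add: pos_divide_le_eq)
  qed
  note comps = this
  have "complementary \<beta>1 p" "complementary \<beta>2 m" "complementary \<beta>3 \<xi>" "complementary \<beta>4 (1 - \<xi>)"
    using comps fe by (simp_all add: complementary_def less_eq_vec_def)
  moreover have "complementary \<pi> (A *v (p - m) - b)"
    using \<pi>(2,3) fe by (auto simp: complementary_def less_eq_vec_def)
  moreover have "- (\<gamma> *\<^sub>R 1) + \<mu> *\<^sub>R (p + m) + (\<beta>4 - \<beta>3) = 0"
    using comps by (simp add: vec_eq_iff algebra_simps)
  moreover have "(p + m) \<bullet> \<xi> = 0"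
    using feas by (simp add: mpcc_feasible_def)
  ultimately have "mpcc_KKT f \<gamma> A b (p, m, \<xi>) \<mu> \<beta>1 \<beta>2 \<beta>3 \<beta>4 \<pi>"
    unfolding mpcc_KKT_def
    by (simp add: GDERIV_imp_grad[OF G] \<pi>(1) \<beta>1_def \<beta>2_def zero_prod_def del: transpose_matrix_vector)
  then show ?thesis
    by blast
qed

theorem theorem1:
  fixes A :: "real ^ 'n ^ 'm" and b :: "real ^ 'm" and \<gamma> :: real
    and f f\<^sub>Q g :: "real ^ 'n \<Rightarrow> real"
    and x :: "(real ^ 'n) \<times> (real ^ 'n) \<times> (real ^ 'n)"
  assumes "\<gamma> > 0"
    and "f = (\<lambda>z. f\<^sub>Q z + g z)"
    and "quadratic_fun f\<^sub>Q"
    and "smooth_fun g"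
    and "convex_on UNIV g"
    and "convex_on UNIV f"
    and "x \<in> mpcc_feasible A b"
  shows "local_minimizer (mpcc_objective f \<gamma>) (mpcc_feasible A b) x \<longleftrightarrow>
         (\<exists>\<mu> \<beta>1 \<beta>2 \<beta>3 \<beta>4 \<pi>. mpcc_KKT f \<gamma> A b x \<mu> \<beta>1 \<beta>2 \<beta>3 \<beta>4 \<pi>)"
proof -
  obtain p m \<xi> where x: "x = (p, m, \<xi>)"
    by (cases x)
  obtain G\<^sub>Q where "GDERIV f\<^sub>Q (p - m) :> G\<^sub>Q"
    using quadratic_fun_GDERIV[OF assms(3)] .
  moreover obtain G\<^sub>g where "GDERIV g (p - m) :> G\<^sub>g"
    using assms(4) unfolding smooth_fun_def by blast
  ultimately have G: "GDERIV f (p - m) :> G\<^sub>Q + G\<^sub>g"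
    unfolding assms(2) by (rule GDERIV_add)
  show ?thesis
    using local_minimizer_imp_mpcc_KKT[OF assms(1) _ G]
      mpcc_KKT_imp_local_minimizer[OF assms(6) G] assms(7)
    unfolding x by blast
qed

end
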